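(* Let $n\in\mathbb{N}$, let $\{y_i\}_{i=1}^N\subset(-1,1)$ be the snapshot set and $\{w_i\}_{i=1}^N\subset\mathbb{R}^+$ positive weights such that $(g,f)_D:=\sum_{i=1}^N g(y_i)f(y_i)w_i$ is an inner product on $\mathcal{P}^n([-1,1])$ and $\sum_{i=1}^N w_i=2$. Let $x(y)\in\mathbb{R}^m$ be the solution to $A(y)x(y)=b$ for $y\in(-1,1)$, and let $\tilde x_{\rm POD}(y)$ be the subspace solution from the rank-$s$ POD subspace $V_{\rm POD}=V_{\rm POD}(s,\{y_i\}_{i=1}^N,\{w_i\}_{i=1}^N)$ defined using the weights $\{w_i\}_{i=1}^N$. Assume that $e<1$, where $$e=\max_{q\in\mathcal{P}^n([-1,1])\setminus\{0\}}\left|\frac{\int_{-1}^1 q(y)^2\,dy-\sum_{i=1}^N q(y_i)^2 w_i}{\int_{-1}^1 q(y)^2\,dy}\right|.$$ Let $\alpha\in\mathcal{P}^n([-1,1];\mathbb{R}^N)$ be such that $$\Phi\alpha(y)=\psi(y)\ \text{ for any } y\in(-1,1)\quad\text{and}\quad\int_{-1}^1\|W^{-1}\alpha(y)\|_2^2\,dy\le\frac{n+1}{1-e},$$ and set $(\Pi_nf)(y)=\sum_{i=1}^N\alpha_i(y)f(y_i)$. Then $$\kappa^{-1}\|x-\tilde x_{\rm POD}\|_{L^2(-1,1;\mathbb{R}^m_{A_0})}\le\sqrt2\,\|(I-\Pi_n)x\|_{L^2(-1,1;\mathbb{R}^m_{A_0})}+\sigma_{s+1}C_{\rm s}(n),$$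 where $\kappa=\left(\frac{1+C}{r}\right)^{1/2}$ and $C_{\rm s}(n)=\left(\frac{2n+2}{1-e}\right)^{1/2}$.
   Context: Model problem. $\Omega\subset\mathbb{R}^d$, $d\in\{2,3\}$, is a domain with Lipschitz boundary; $L:H^1_0(\Omega)\to\mathbb{R}$ is a bounded linear functional; $a_0,a_1:H^1_0(\Omega)\times H^1_0(\Omega)\to\mathbb{R}$ are symmetric continuous bilinear forms, $a_0$ is coercive, $a_1$ is positive semidefinite, and $0<r<1$ is such that $a_1(v,v)\le(1-r)a_0(v,v)$ for all $v\in H^1_0(\Omega)$. $C>0$ is a constant such that $|a_1(v,z)|\le C\,a_0(v,v)^{1/2}a_0(z,z)^{1/2}$ for all $v,z\in H^1_0(\Omega)$. $X_h\subset H^1_0(\Omega)$ is a finite-dimensional (finite element) subspace with basis $\{\varphi_i\}_{i=1}^m$. Define $A_0,A_1\in\mathbb{R}^{m\times m}$ by $[A_0]_{ij}=a_0(\varphi_i,\varphi_j)$, $[A_1]_{ij}=a_1(\varphi_i,\varphi_j)$, set $A(y)=A_0+yA_1$ for $y\in(-1,1)$, and $b\in\mathbb{R}^m$, $b_i=L(\varphi_i)$. The matrices $A_0$ and $A(y)$ are symmetric positive definite. Subspace solution. For a subspace $V\subset\mathbb{R}^m$ with basis matrix $Q\in\mathbb{R}^{m\times k}$ (columns of $Q$ form a basis of $V$), the subspace solution of $A(y)x(y)=b$ from $V$ is $\tilde x(y)=Qz(y)$, where $Q^TA(y)Qz(y)=Q^Tb$. Norms and spaces. $\|z\|_{A_0}=(z^TA_0z)^{1/2}$,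 and $\mathbb{R}^m_{A_0}$ is $\mathbb{R}^m$ with this norm; $\|f\|_{L^2(-1,1;\mathbb{R}^m_{A_0})}=\left(\int_{-1}^1\|f(y)\|_{A_0}^2\,dy\right)^{1/2}$. For $B\in\mathbb{R}^{m\times N}$, $\|B\|_{2,A_0}=\max_{\eta\in\mathbb{R}^N\setminus\{0\}}\|B\eta\|_{A_0}/\|\eta\|_2$. $\mathcal{P}^n([-1,1])$ is the space of real polynomials of degree at most $n$ on $[-1,1]$, and $\mathcal{P}^n([-1,1];\mathbb{R}^N)$ the space of $\mathbb{R}^N$-valued functions with components in $\mathcal{P}^n([-1,1])$. POD subspace. Let $X=[x(y_1)\ \cdots\ x(y_N)]\in\mathbb{R}^{m\times N}$, $W=\mathrm{diag}(\sqrt{w_1},\ldots,\sqrt{w_N})$, $\tilde X=XW$. For a positive integer $s$, let $\tilde X_s$ be the best rank-$s$ approximation to $\tilde X$ in the norm $\|\cdot\|_{2,A_0}$, and $\sigma_{s+1}=\|\tilde X-\tilde X_s\|_{2,A_0}$. Then $V_{\rm POD}(s,\{y_i\},\{w_i\})$ is the range of $\tilde X_s$. Approximation operator. $\{P_j\}_{j=0}^n$ is a $(\cdot,\cdot)_D$-orthogonal basis of $\mathcal{P}^n([-1,1])$ normalized so that $\int_{-1}^1P_j(y)^2\,dy=1$ for every $j$. $\Phi\in\mathbb{R}^{(n+1)\times N}$ is the matrix with rows indexed by $j=0,\ldots,n$, columns by $i=1,\ldots,N$, and entries $P_j(y_i)$; $\psi(y)=(P_0(y),\ldots,P_n(y))^T$.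 A function $\alpha$ with the two required properties exists whenever $e<1$. $I$ is the identity operator. *)

theory Defs
  imports "HOL-Analysis.Analysis" "HOL-Computational_Algebra.Polynomial"
begin

text \<open>Near every boundary point \<open>\<Omega>\<close> is the set strictly above a Lipschitz graph over the
  hyperplane orthogonal to some unit vector \<open>\<nu>\<close>.\<close>

definition lipschitz_boundary :: "'a::euclidean_space set \<Rightarrow> bool" where
  "lipschitz_boundary \<Omega> \<longleftrightarrow>
     (\<forall>p\<in>frontier \<Omega>. \<exists>\<nu> \<rho> K \<gamma>. norm \<nu> = 1 \<and> \<rho> > 0 \<and> lipschitz_on K {q. q \<bullet> \<nu> = 0} \<gamma> \<and>
        (\<forall>q\<in>ball p \<rho>. q \<in> \<Omega> \<longleftrightarrow> (\<gamma> (q - (q \<bullet> \<nu>) *\<^sub>R \<nu>) :: real) < q \<bullet> \<nu>))"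

definition lipschitz_domain :: "'a::euclidean_space set \<Rightarrow> bool" where
  "lipschitz_domain \<Omega> \<longleftrightarrow> open \<Omega> \<and> connected \<Omega> \<and> \<Omega> \<noteq> {} \<and> lipschitz_boundary \<Omega>"

definition partial :: "'a::euclidean_space \<Rightarrow> ('a \<Rightarrow> real) \<Rightarrow> 'a \<Rightarrow> real" where
  "partial b f = (\<lambda>x. frechet_derivative f (at x) b)"

text \<open>All iterated partial derivatives exist and are (totally) differentiable; in particular
  they are continuous.\<close>

definition smooth :: "('a::euclidean_space \<Rightarrow> real) \<Rightarrow> bool" where
  "smooth f \<longleftrightarrow> (\<forall>bs. set bs \<subseteq> Basis \<longrightarrow> (foldr partial bs f) differentiable_on UNIV)"

definition test_functions :: "'a::euclidean_space set \<Rightarrow> ('a \<Rightarrow> real) set" where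
  "test_functions \<Omega> =
     {f. smooth f \<and> compact (closure {x. f x \<noteq> 0}) \<and> closure {x. f x \<noteq> 0} \<subseteq> \<Omega>}"

text \<open>Elements of Lebesgue and Sobolev spaces are represented by functions on the whole space;
  the values outside \<open>\<Omega>\<close> and on null sets are irrelevant. Thus \<open>H1_norm\<close> below is a
  seminorm on representatives, which vanishes exactly on the functions that are zero almost
  everywhere in \<open>\<Omega>\<close>; a form or functional that is bounded with respect to it depends only on
  the classes.\<close>

definition L2 :: "'a::euclidean_space set \<Rightarrow> ('a \<Rightarrow> real) set" where
  "L2 \<Omega> = {u. u \<in> borel_measurable (lebesgue_on \<Omega>) \<and> integrable (lebesgue_on \<Omega>) (\<lambda>x. (u x)\<^sup>2)}"

definition weak_partial ::
    "'a::euclidean_space set \<Rightarrow> 'a \<Rightarrow> ('a \<Rightarrow> real) \<Rightarrow> ('a \<Rightarrow> real) \<Rightarrow> bool" where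
  "weak_partial \<Omega> b u g \<longleftrightarrow>
     (\<forall>\<phi>\<in>test_functions \<Omega>.
        (LINT x|lebesgue_on \<Omega>. u x * partial b \<phi> x) = - (LINT x|lebesgue_on \<Omega>. g x * \<phi> x))"

definition H1 :: "'a::euclidean_space set \<Rightarrow> ('a \<Rightarrow> real) set" where
  "H1 \<Omega> = {u \<in> L2 \<Omega>. \<forall>b\<in>Basis. \<exists>g\<in>L2 \<Omega>. weak_partial \<Omega> b u g}"

text \<open>On an open set weak derivatives are unique up to null sets, so the choice is immaterial.\<close>

definition weak_grad ::
    "'a::euclidean_space set \<Rightarrow> ('a \<Rightarrow> real) \<Rightarrow> 'a \<Rightarrow> 'a \<Rightarrow> real" where
  "weak_grad \<Omega> u b = (SOME g. g \<in> L2 \<Omega> \<and> weak_partial \<Omega> b u g)"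

definition H1_norm :: "'a::euclidean_space set \<Rightarrow> ('a \<Rightarrow> real) \<Rightarrow> real" where
  "H1_norm \<Omega> u =
     sqrt ((LINT x|lebesgue_on \<Omega>. (u x)\<^sup>2) +
           (\<Sum>b\<in>Basis. LINT x|lebesgue_on \<Omega>. (weak_grad \<Omega> u b x)\<^sup>2))"

definition H10 :: "'a::euclidean_space set \<Rightarrow> ('a \<Rightarrow> real) set" where
  "H10 \<Omega> = {u \<in> H1 \<Omega>. \<forall>\<epsilon>>0. \<exists>\<phi>\<in>test_functions \<Omega>. H1_norm \<Omega> (\<lambda>x. u x - \<phi> x) < \<epsilon>}"

definition bounded_functional ::
    "'a::euclidean_space set \<Rightarrow> (('a \<Rightarrow> real) \<Rightarrow> real) \<Rightarrow> bool" where
  "bounded_functional \<Omega> L \<longleftrightarrow>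
     (\<forall>u\<in>H10 \<Omega>. \<forall>v\<in>H10 \<Omega>. L (\<lambda>x. u x + v x) = L u + L v) \<and>
     (\<forall>c. \<forall>u\<in>H10 \<Omega>. L (\<lambda>x. c * u x) = c * L u) \<and>
     (\<exists>M. \<forall>u\<in>H10 \<Omega>. \<bar>L u\<bar> \<le> M * H1_norm \<Omega> u)"

definition symmetric_form ::
    "'a::euclidean_space set \<Rightarrow> (('a \<Rightarrow> real) \<Rightarrow> ('a \<Rightarrow> real) \<Rightarrow> real) \<Rightarrow> bool" where
  "symmetric_form \<Omega> a \<longleftrightarrow> (\<forall>u\<in>H10 \<Omega>. \<forall>v\<in>H10 \<Omega>. a u v = a v u)"

definition continuous_bilinear_form ::
    "'a::euclidean_space set \<Rightarrow> (('a \<Rightarrow> real) \<Rightarrow> ('a \<Rightarrow> real) \<Rightarrow> real) \<Rightarrow> bool" where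
  "continuous_bilinear_form \<Omega> a \<longleftrightarrow>
     (\<forall>u\<in>H10 \<Omega>. \<forall>v\<in>H10 \<Omega>. \<forall>w\<in>H10 \<Omega>.
        a (\<lambda>x. u x + v x) w = a u w + a v w \<and> a w (\<lambda>x. u x + v x) = a w u + a w v) \<and>
     (\<forall>c. \<forall>u\<in>H10 \<Omega>. \<forall>v\<in>H10 \<Omega>.
        a (\<lambda>x. c * u x) v = c * a u v \<and> a u (\<lambda>x. c * v x) = c * a u v) \<and>
     (\<exists>M. \<forall>u\<in>H10 \<Omega>. \<forall>v\<in>H10 \<Omega>. \<bar>a u v\<bar> \<le> M * H1_norm \<Omega> u * H1_norm \<Omega> v)"

definition coercive_form ::
    "'a::euclidean_space set \<Rightarrow> (('a \<Rightarrow> real) \<Rightarrow> ('a \<Rightarrow> real) \<Rightarrow> real) \<Rightarrow> bool" where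
  "coercive_form \<Omega> a \<longleftrightarrow> (\<exists>c>0. \<forall>u\<in>H10 \<Omega>. a u u \<ge> c * (H1_norm \<Omega> u)\<^sup>2)"

definition psd_form ::
    "'a::euclidean_space set \<Rightarrow> (('a \<Rightarrow> real) \<Rightarrow> ('a \<Rightarrow> real) \<Rightarrow> real) \<Rightarrow> bool" where
  "psd_form \<Omega> a \<longleftrightarrow> (\<forall>u\<in>H10 \<Omega>. a u u \<ge> 0)"

definition linear_subspace :: "('a \<Rightarrow> real) set \<Rightarrow> bool" where
  "linear_subspace S \<longleftrightarrow>
     (\<lambda>x. 0) \<in> S \<and> (\<forall>u\<in>S. \<forall>v\<in>S. (\<lambda>x. u x + v x) \<in> S) \<and> (\<forall>c. \<forall>u\<in>S. (\<lambda>x. c * u x) \<in> S)"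

text \<open>Spanning and linear independence are understood up to equality almost everywhere in
  \<open>\<Omega>\<close>, that is, for the classes.\<close>

definition basis_of ::
    "'a::euclidean_space set \<Rightarrow> ('a \<Rightarrow> real) set \<Rightarrow> ('m::finite \<Rightarrow> 'a \<Rightarrow> real) \<Rightarrow> bool" where
  "basis_of \<Omega> S \<phi> \<longleftrightarrow>
     (\<forall>i. \<phi> i \<in> S) \<and>
     (\<forall>v\<in>S. \<exists>c. AE x in lebesgue_on \<Omega>. v x = (\<Sum>i\<in>UNIV. c i * \<phi> i x)) \<and>
     (\<forall>c. (AE x in lebesgue_on \<Omega>. (\<Sum>i\<in>UNIV. c i * \<phi> i x) = 0) \<longrightarrow> (\<forall>i. c i = 0))"

definition form_matrix ::
    "(('a \<Rightarrow> real) \<Rightarrow> ('a \<Rightarrow> real) \<Rightarrow> real) \<Rightarrow> ('m::finite \<Rightarrow> 'a \<Rightarrow> real) \<Rightarrow> real^'m^'m" where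
  "form_matrix a \<phi> = (\<chi> i j. a (\<phi> i) (\<phi> j))"

definition load_vector ::
    "(('a \<Rightarrow> real) \<Rightarrow> real) \<Rightarrow> ('m::finite \<Rightarrow> 'a \<Rightarrow> real) \<Rightarrow> real^'m" where
  "load_vector L \<phi> = (\<chi> i. L (\<phi> i))"

definition mat_norm :: "real^'m^'m \<Rightarrow> real^'m \<Rightarrow> real" where
  "mat_norm A z = sqrt (z \<bullet> (A *v z))"

definition L2_norm :: "real^'m^'m \<Rightarrow> (real \<Rightarrow> real^'m) \<Rightarrow> real" where
  "L2_norm A f = sqrt (LINT y:{-1<..<1}|lborel. (mat_norm A (f y))\<^sup>2)"

definition op_norm :: "real^'m^'m \<Rightarrow> real^'N^'m \<Rightarrow> real" where
  "op_norm A B = (SUP \<eta>\<in>UNIV - {0}. mat_norm A (B *v \<eta>) / norm \<eta>)"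

text \<open>The basis matrix \<open>Q\<close> with \<open>k\<close> columns is given by its columns \<open>Q 0, \<dots>, Q (k - 1)\<close>, so
  that \<open>k\<close> is a number (possibly 0, for the trivial subspace) and \<open>Q z\<close> is the linear
  combination of the columns; the second line is the Galerkin system
  \<open>Q\<^sup>T M Q z = Q\<^sup>T b\<close>, row by row.\<close>

definition basis_matrix :: "(real^'m) set \<Rightarrow> nat \<Rightarrow> (nat \<Rightarrow> real^'m) \<Rightarrow> bool" where
  "basis_matrix V k Q \<longleftrightarrow>
     inj_on Q {..<k} \<and> independent (Q ` {..<k}) \<and> span (Q ` {..<k}) = V"

definition subspace_solution ::
    "(real^'m) set \<Rightarrow> real^'m^'m \<Rightarrow> real^'m \<Rightarrow> real^'m \<Rightarrow> bool" where
  "subspace_solution V M b u \<longleftrightarrow>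
     (\<exists>k Q z. basis_matrix V k Q \<and> u = (\<Sum>j<k. z j *\<^sub>R Q j) \<and>
        (\<forall>i<k. Q i \<bullet> (M *v (\<Sum>j<k. z j *\<^sub>R Q j)) = Q i \<bullet> b))"

definition snapshot_matrix :: "(real \<Rightarrow> real^'m) \<Rightarrow> ('N \<Rightarrow> real) \<Rightarrow> real^'N^'m" where
  "snapshot_matrix x y = (\<chi> i j. x (y j) $ i)"

definition weight_matrix :: "('N \<Rightarrow> real) \<Rightarrow> real^'N^'N" where
  "weight_matrix w = (\<chi> i j. if i = j then sqrt (w i) else 0)"

text \<open>A best approximation in this norm is in general not unique, hence a predicate. The rank is
  only bounded by \<open>s\<close>: if \<open>X\<close> itself has smaller rank, a matrix of exact rank \<open>s\<close> need not
  minimize.\<close>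

definition best_rank_approx :: "real^'m^'m \<Rightarrow> nat \<Rightarrow> real^'N^'m \<Rightarrow> real^'N^'m \<Rightarrow> bool" where
  "best_rank_approx A s X B \<longleftrightarrow>
     rank B \<le> s \<and> (\<forall>B'. rank B' \<le> s \<longrightarrow> op_norm A (X - B) \<le> op_norm A (X - B'))"

definition Pn :: "nat \<Rightarrow> real poly set" where
  "Pn n = {p. degree p \<le> n}"

definition discrete_ip ::
    "('N::finite \<Rightarrow> real) \<Rightarrow> ('N \<Rightarrow> real) \<Rightarrow> real poly \<Rightarrow> real poly \<Rightarrow> real" where
  "discrete_ip y w g f = (\<Sum>i\<in>UNIV. poly g (y i) * poly f (y i) * w i)"

definition inner_product_on ::
    "real poly set \<Rightarrow> (real poly \<Rightarrow> real poly \<Rightarrow> real) \<Rightarrow> bool" where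
  "inner_product_on S ip \<longleftrightarrow>
     (\<forall>f\<in>S. \<forall>g\<in>S. ip f g = ip g f) \<and>
     (\<forall>f\<in>S. \<forall>g\<in>S. \<forall>h\<in>S. ip (f + g) h = ip f h + ip g h) \<and>
     (\<forall>c. \<forall>f\<in>S. \<forall>g\<in>S. ip (smult c f) g = c * ip f g) \<and>
     (\<forall>f\<in>S. f \<noteq> 0 \<longrightarrow> ip f f > 0)"

definition quad_error :: "nat \<Rightarrow> ('N::finite \<Rightarrow> real) \<Rightarrow> ('N \<Rightarrow> real) \<Rightarrow> real" where
  "quad_error n y w =
     (SUP q\<in>Pn n - {0}.
        \<bar>((LINT t:{-1..1}|lborel. (poly q t)\<^sup>2) - (\<Sum>i\<in>UNIV. (poly q (y i))\<^sup>2 * w i)) /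
         (LINT t:{-1..1}|lborel. (poly q t)\<^sup>2)\<bar>)"

definition normalized_orthogonal_basis ::
    "nat \<Rightarrow> (real poly \<Rightarrow> real poly \<Rightarrow> real) \<Rightarrow> (nat \<Rightarrow> real poly) \<Rightarrow> bool" where
  "normalized_orthogonal_basis n ip P \<longleftrightarrow>
     (\<forall>j\<le>n. P j \<in> Pn n) \<and>
     (\<forall>q\<in>Pn n. \<exists>!c. (\<forall>j>n. c j = 0) \<and> q = (\<Sum>j\<le>n. smult (c j) (P j))) \<and>
     (\<forall>i\<le>n. \<forall>j\<le>n. i \<noteq> j \<longrightarrow> ip (P i) (P j) = 0) \<and>
     (\<forall>j\<le>n. (LINT t:{-1..1}|lborel. (poly (P j) t)\<^sup>2) = 1)"

definition poly_vec :: "('N::finite \<Rightarrow> real poly) \<Rightarrow> real \<Rightarrow> real^'N" where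
  "poly_vec \<alpha> t = (\<chi> i. poly (\<alpha> i) t)"

text \<open>Row \<open>j\<close>, for \<open>j = 0, \<dots>, n\<close>, of the matrix with entries \<open>P j (y i)\<close>.\<close>

definition Phi_row :: "(nat \<Rightarrow> real poly) \<Rightarrow> ('N::finite \<Rightarrow> real) \<Rightarrow> nat \<Rightarrow> real^'N" where
  "Phi_row P y j = (\<chi> i. poly (P j) (y i))"

definition approx_op ::
    "('N::finite \<Rightarrow> real poly) \<Rightarrow> ('N \<Rightarrow> real) \<Rightarrow> (real \<Rightarrow> real^'m) \<Rightarrow> real \<Rightarrow> real^'m" where
  "approx_op \<alpha> y f t = (\<Sum>i\<in>UNIV. poly (\<alpha> i) t *\<^sub>R f (y i))"

end

theory Submission
  imports Defs
begin

text \<open>Galerkin orthogonality makes the subspace solution the best approximation from \<open>VPOD\<close> in the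
  energy norm of \<open>A t\<close>, which is equivalent to the \<open>A0\<close> norm with constants \<open>r\<close> and \<open>1 + C\<close>.
  The competitor \<open>Xs W\<inverse> \<alpha>(t)\<close> differs from \<open>x(t)\<close> by the interpolation error plus
  \<open>(Xt - Xs) W\<inverse> \<alpha>(t)\<close>, and \<open>(p + q)\<^sup>2 \<le> 2 p\<^sup>2 + 2 q\<^sup>2\<close> is then integrated over \<open>t\<close>.\<close>

section \<open>Forms on the finite element space and their matrices\<close>

lemma linear_subspace_sum:
  assumes "linear_subspace S" "\<And>i. i \<in> I \<Longrightarrow> \<phi> i \<in> S"
  shows "(\<lambda>p. \<Sum>i\<in>I. c i * \<phi> i p) \<in> S"
  using assms by (induction I rule: infinite_finite_induct) (auto simp: linear_subspace_def)

lemma bilinear_form_zero: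
  assumes "continuous_bilinear_form \<Omega> a" "v \<in> H10 \<Omega>"
  shows "a (\<lambda>p. 0) v = 0" "a v (\<lambda>p. 0) = 0"
proof -
  have "a (\<lambda>p. 0 * v p) v = 0 * a v v" "a v (\<lambda>p. 0 * v p) = 0 * a v v"
    using assms unfolding continuous_bilinear_form_def by blast+
  then show "a (\<lambda>p. 0) v = 0" "a v (\<lambda>p. 0) = 0" by simp_all
qed

text \<open>The forms are additive only for arguments in \<open>H10 \<Omega>\<close>, so the
  induction needs every partial sum to lie there. The subspace \<open>S\<close> provides this
  closure. Both slots are treated in one induction.\<close>

lemma bilinear_form_sum:
  assumes a: "continuous_bilinear_form \<Omega> a" and S: "linear_subspace S" "S \<subseteq> H10 \<Omega>"
    and \<phi>: "\<And>i. i \<in> I \<Longrightarrow> \<phi> i \<in> S" and v: "v \<in> H10 \<Omega>"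
  shows "a (\<lambda>p. \<Sum>i\<in>I. c i * \<phi> i p) v = (\<Sum>i\<in>I. c i * a (\<phi> i) v)"
    and "a v (\<lambda>p. \<Sum>i\<in>I. c i * \<phi> i p) = (\<Sum>i\<in>I. c i * a v (\<phi> i))"
proof -
  have "a (\<lambda>p. \<Sum>i\<in>I. c i * \<phi> i p) v = (\<Sum>i\<in>I. c i * a (\<phi> i) v) \<and>
        a v (\<lambda>p. \<Sum>i\<in>I. c i * \<phi> i p) = (\<Sum>i\<in>I. c i * a v (\<phi> i))"
    using \<phi>
  proof (induction I rule: infinite_finite_induct)
    case (insert j I)
    define f where "f = (\<lambda>p. c j * \<phi> j p)"
    define g where "g = (\<lambda>p. \<Sum>i\<in>I. c i * \<phi> i p)"
    have j: "\<phi> j \<in> H10 \<Omega>" using insert.prems S by auto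
    have f: "f \<in> H10 \<Omega>"
      using insert.prems S by (auto simp: f_def linear_subspace_def)
    have g: "g \<in> H10 \<Omega>"
      using linear_subspace_sum[OF S(1), of I \<phi> c] insert.prems S(2) by (auto simp: g_def)
    have "a (\<lambda>p. f p + g p) v = a f v + a g v" "a v (\<lambda>p. f p + g p) = a v f + a v g"
      using a f g v unfolding continuous_bilinear_form_def by blast+
    moreover have "a f v = c j * a (\<phi> j) v" "a v f = c j * a v (\<phi> j)"
      using a j v unfolding continuous_bilinear_form_def f_def by blast+
    ultimately show ?case
      using insert by (simp add: f_def g_def)
  qed (use bilinear_form_zero[OF a v] in simp_all)
  then show "a (\<lambda>p. \<Sum>i\<in>I. c i * \<phi> i p) v = (\<Sum>i\<in>I. c i * a (\<phi> i) v)"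
    and "a v (\<lambda>p. \<Sum>i\<in>I. c i * \<phi> i p) = (\<Sum>i\<in>I. c i * a v (\<phi> i))" by auto
qed

text \<open>Carries the hypotheses on \<open>a0\<close> and \<open>a1\<close> over to the matrices
  \<open>A0\<close> and \<open>A1\<close>.\<close>

lemma inner_form_matrix:
  fixes \<phi> :: "'m::finite \<Rightarrow> 'a::euclidean_space \<Rightarrow> real"
  assumes a: "continuous_bilinear_form \<Omega> a" and S: "linear_subspace S" "S \<subseteq> H10 \<Omega>"
    and \<phi>: "\<And>i. \<phi> i \<in> S"
  shows "u \<bullet> (form_matrix a \<phi> *v v) =
           a (\<lambda>p. \<Sum>i\<in>UNIV. u $ i * \<phi> i p) (\<lambda>p. \<Sum>i\<in>UNIV. v $ i * \<phi> i p)"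
proof -
  have v: "(\<lambda>p. \<Sum>i\<in>UNIV. v $ i * \<phi> i p) \<in> H10 \<Omega>"
    using linear_subspace_sum[OF S(1), of UNIV \<phi>] \<phi> S(2) by blast
  have \<phi>H: "\<phi> i \<in> H10 \<Omega>" for i using \<phi> S(2) by blast
  show ?thesis
    by (simp add: bilinear_form_sum[OF a S \<phi> v] bilinear_form_sum[OF a S \<phi> \<phi>H]
        inner_vec_def matrix_vector_mult_def form_matrix_def mult.commute)
qed

lemma transpose_form_matrix:
  assumes "symmetric_form \<Omega> a" "\<And>i. \<phi> i \<in> H10 \<Omega>"
  shows "transpose (form_matrix a \<phi>) = form_matrix a \<phi>"
  using assms by (simp add: transpose_def form_matrix_def symmetric_form_def vec_eq_iff)

text \<open>\<open>H1_norm\<close> is only a seminorm on representatives, but it dominates the L2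
  norm, and the integral of a square vanishes only if the function is zero almost
  everywhere.\<close>

lemma coercive_form_pos:
  assumes a: "coercive_form \<Omega> a" and u: "u \<in> H10 \<Omega>" "\<not> (AE p in lebesgue_on \<Omega>. u p = 0)"
  shows "a u u > 0"
proof -
  have int: "integrable (lebesgue_on \<Omega>) (\<lambda>p. (u p)\<^sup>2)"
    using u(1) by (auto simp: H10_def H1_def L2_def)
  have "(LINT p|lebesgue_on \<Omega>. (u p)\<^sup>2) \<noteq> 0"
    using integral_nonneg_eq_0_iff_AE[OF int] u(2) by auto
  then have "(LINT p|lebesgue_on \<Omega>. (u p)\<^sup>2) > 0"
    by (simp add: less_le)
  moreover have "(\<Sum>b\<in>Basis. LINT p|lebesgue_on \<Omega>. (weak_grad \<Omega> u b p)\<^sup>2) \<ge> 0"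
    by (intro sum_nonneg) simp
  ultimately have "H1_norm \<Omega> u > 0"
    unfolding H1_norm_def by simp
  then show ?thesis
    using a u(1) unfolding coercive_form_def
    by (metis less_le_trans mult_pos_pos zero_less_power)
qed

section \<open>Galerkin orthogonality and best approximation\<close>

lemma inner_matrix_symmetric:
  fixes M :: "real^'n^'n"
  assumes "transpose M = M"
  shows "u \<bullet> (M *v v) = v \<bullet> (M *v u)"
  by (metis assms dot_lmul_matrix inner_commute transpose_matrix_vector)

text \<open>Cea's lemma in the energy norm of \<open>M\<close>: the error \<open>x - u\<close> is
  orthogonal to \<open>V\<close>, and Pythagoras applies to
  \<open>x - v = (x - u) + (u - v)\<close>.\<close>

lemma subspace_solution_best:
  fixes M :: "real^'m^'m"
  assumes M: "transpose M = M" "\<And>z. 0 \<le> z \<bullet> (M *v z)" "M *v x = b"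
    and u: "subspace_solution V M b u" and v: "v \<in> V"
  shows "(x - u) \<bullet> (M *v (x - u)) \<le> (x - v) \<bullet> (M *v (x - v))"
proof -
  obtain k Q z where Q: "basis_matrix V k Q" "u = (\<Sum>j<k. z j *\<^sub>R Q j)"
    and eq: "\<And>i. i < k \<Longrightarrow> Q i \<bullet> (M *v u) = Q i \<bullet> b"
    using u unfolding subspace_solution_def by blast
  have V: "V = span (Q ` {..<k})"
    using Q(1) by (simp add: basis_matrix_def)
  have "u \<in> V"
    unfolding Q(2) V by (intro span_sum span_scale span_base) auto
  then have "u - v \<in> span (Q ` {..<k})"
    using v V span_diff by blast
  \<comment> \<open>For a column \<open>Q i\<close> this is row \<open>i\<close> of the Galerkin
    system, because \<open>M *v x = b\<close>; linearity extends it to the span.\<close>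
  then have orth: "(u - v) \<bullet> (M *v (x - u)) = 0"
  proof (induction rule: span_induct_alt)
    case (step c q p)
    then show ?case
      using eq by (auto simp: inner_add_left M(3) algebra_simps inner_diff_right)
  qed simp
  have "x - v = (x - u) + (u - v)" by simp
  then have "(x - v) \<bullet> (M *v (x - v)) =
      (x - u) \<bullet> (M *v (x - u)) + (u - v) \<bullet> (M *v (u - v))"
    using orth inner_matrix_symmetric[OF M(1), of "x - u" "u - v"]
    by (simp only: matrix_vector_right_distrib inner_add_left inner_add_right)
  then show ?thesis
    using M(2)[of "u - v"] by simp
qed

section \<open>The norm of a matrix and the induced operator norm\<close>

lemma mat_norm_add_sq:
  fixes M :: "real^'m^'m"
  assumes "\<And>z. 0 \<le> z \<bullet> (M *v z)"
  shows "(mat_norm M (u + v))\<^sup>2 \<le> 2 * (mat_norm M u)\<^sup>2 + 2 * (mat_norm M v)\<^sup>2"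
proof -
  \<comment> \<open>Parallelogram identity: this quantity is exactly the right side minus the left
    side of the claim.\<close>
  have "0 \<le> (u - v) \<bullet> (M *v (u - v))" by (rule assms)
  moreover have "(mat_norm M z)\<^sup>2 = z \<bullet> (M *v z)" for z
    by (simp add: mat_norm_def assms)
  ultimately show ?thesis
    by (simp add: algebra_simps inner_add_left inner_add_right
        inner_diff_left inner_diff_right matrix_vector_right_distrib)
qed

text \<open>The supremum in \<open>op_norm\<close> is taken over the reals and bounds its members
  only if they are bounded above; this supplies the bound.\<close>

lemma mat_norm_bounded:
  fixes M :: "real^'m^'m" and B :: "real^'N^'m"
  obtains K where "\<And>\<eta>. mat_norm M (B *v \<eta>) \<le> K * norm \<eta>"
proof -
  obtain K where K: "\<And>z. norm (M *v z) \<le> norm z * K"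
    using bounded_linear.bounded[OF matrix_vector_mul_bounded_linear] by blast
  obtain H where H: "\<And>z. norm (B *v z) \<le> norm z * H"
    using bounded_linear.bounded[OF matrix_vector_mul_bounded_linear] by blast
  \<comment> \<open>The signs of \<open>K\<close> and \<open>H\<close> are not known, hence the
    absolute values.\<close>
  have "mat_norm M (B *v \<eta>) \<le> sqrt \<bar>K\<bar> * \<bar>H\<bar> * norm \<eta>" for \<eta>
  proof -
    define z where "z = B *v \<eta>"
    have "z \<bullet> (M *v z) \<le> norm z * norm (M *v z)"
      by (rule norm_cauchy_schwarz)
    also have "\<dots> \<le> norm z * (norm z * \<bar>K\<bar>)"
      by (intro mult_left_mono order_trans[OF K]) auto
    finally have "mat_norm M z \<le> sqrt ((norm z)\<^sup>2 * \<bar>K\<bar>)"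
      unfolding mat_norm_def by (intro real_sqrt_le_mono) (simp add: power2_eq_square mult.assoc)
    also have "\<dots> = sqrt \<bar>K\<bar> * norm z"
      by (simp add: real_sqrt_mult)
    also have "norm z \<le> norm \<eta> * \<bar>H\<bar>"
      unfolding z_def by (intro order_trans[OF H] mult_left_mono) auto
    finally show ?thesis
      by (simp add: z_def mult_left_mono mult.assoc mult.commute[of "\<bar>H\<bar>"])
  qed
  then show ?thesis using that by blast
qed

lemma mat_norm_le_op_norm:
  fixes M :: "real^'m^'m" and B :: "real^'N^'m"
  shows "mat_norm M (B *v \<eta>) \<le> op_norm M B * norm \<eta>"
proof (cases "\<eta> = 0")
  case True
  then show ?thesis by (simp add: mat_norm_def)
next
  case False
  obtain K where K: "\<And>\<eta>. mat_norm M (B *v \<eta>) \<le> K * norm \<eta>"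
    using mat_norm_bounded by blast
  have "bdd_above ((\<lambda>\<eta>. mat_norm M (B *v \<eta>) / norm \<eta>) ` (UNIV - {0}))"
    by (rule bdd_aboveI2[where M = K]) (simp add: divide_le_eq K)
  then have "mat_norm M (B *v \<eta>) / norm \<eta> \<le> op_norm M B"
    unfolding op_norm_def using False by (intro cSUP_upper) auto
  then show ?thesis using False by (simp add: divide_le_eq)
qed

lemma op_norm_nonneg:
  fixes M :: "real^'m^'m" and B :: "real^'N^'m"
  assumes "\<And>z. 0 \<le> z \<bullet> (M *v z)"
  shows "0 \<le> op_norm M B"
proof -
  \<comment> \<open>The supremum lies above its value at a unit vector; index types are nonempty, so
    any coordinate serves.\<close>
  have "0 \<le> mat_norm M (B *v axis undefined 1)"
    by (simp add: mat_norm_def assms)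
  also have "\<dots> \<le> op_norm M B"
    using mat_norm_le_op_norm[of M B "axis undefined 1"] by simp
  finally show ?thesis .
qed

lemma L2_norm_nonneg: "0 \<le> L2_norm M f"
  unfolding L2_norm_def set_lebesgue_integral_def by (intro real_sqrt_ge_zero integral_nonneg) simp

section \<open>Solvability and continuous dependence on the parameter\<close>

text \<open>Cramer's rule extends the solution from the open to the closed interval, which yields its
  integrability.\<close>

lemma continuous_linear_system_solution:
  fixes A :: "'a::topological_space \<Rightarrow> real^'m^'m"
  assumes A: "continuous_on S A" and inv: "\<And>t. t \<in> S \<Longrightarrow> det (A t) \<noteq> 0"
  obtains z where "continuous_on S z" "\<And>t v. t \<in> S \<Longrightarrow> A t *v v = b \<longleftrightarrow> v = z t"
proof
  let ?z = "\<lambda>t. \<chi> k. det (\<chi> i j. if j = k then b $ i else A t $ i $ j) / det (A t)"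
  show "A t *v v = b \<longleftrightarrow> v = ?z t" if "t \<in> S" for t v
    using cramer[OF inv[OF that]] by blast
  have entry: "continuous_on S (\<lambda>t. if j = k then b $ i else A t $ i $ j)" for i j k
    using A by (cases "j = k") (auto intro!: continuous_intros)
  \<comment> \<open>Expanded, both determinants are finite sums of products of continuous entries,
    and the denominator does not vanish on \<open>S\<close>.\<close>
  show "continuous_on S ?z"
    unfolding det_def using A inv[unfolded det_def]
    by (intro continuous_intros entry) (auto intro!: entry)
qed

lemma det_nonzero_of_definite:
  fixes M :: "real^'m^'m"
  assumes "\<And>z. z \<noteq> 0 \<Longrightarrow> 0 < z \<bullet> (M *v z)"
  shows "det M \<noteq> 0"
proof -
  have "\<forall>z. M *v z = 0 \<longrightarrow> z = 0"
    using assms by (metis inner_zero_right less_irrefl)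
  then have "invertible M"
    by (simp add: invertible_left_inverse matrix_left_invertible_ker)
  then show ?thesis
    by (simp add: invertible_det_nz)
qed

section \<open>Weights, snapshots and the approximation operator\<close>

lemma matrix_mult_matrix_inv:
  assumes "invertible M"
  shows "M ** matrix_inv M = mat 1"
proof -
  obtain N where "M ** N = mat 1 \<and> N ** M = mat 1"
    using assms unfolding invertible_def by blast
  \<comment> \<open>\<open>matrix_inv\<close> is a choice among the two-sided inverses, so it has
    their properties once one exists.\<close>
  then have "M ** matrix_inv M = mat 1 \<and> matrix_inv M ** M = mat 1"
    unfolding matrix_inv_def by (rule someI)
  then show ?thesis ..
qed

lemma weight_matrix_inverse:
  fixes w :: "'N::finite \<Rightarrow> real"
  assumes "\<And>i. w i > 0"
  shows "weight_matrix w ** matrix_inv (weight_matrix w) = mat 1"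
proof -
  have "w i \<noteq> 0" for i
    using assms[of i] by simp
  then have "weight_matrix w ** (\<chi> i j. if i = j then inverse (sqrt (w i)) else 0) = mat 1"
    by (simp add: weight_matrix_def matrix_matrix_mult_def mat_def vec_eq_iff
        if_distrib[where f = "\<lambda>x. x * _"] cong: if_cong)
  then have "invertible (weight_matrix w)"
    unfolding invertible_right_inverse by (rule exI)
  then show ?thesis
    by (rule matrix_mult_matrix_inv)
qed

text \<open>Writing the approximation operator as a matrix product lets it be compared with the same
  product formed from the low-rank matrix.\<close>

lemma snapshot_matrix_mult:
  "snapshot_matrix x y *v poly_vec \<alpha> t = approx_op \<alpha> y x t"
  by (simp add: snapshot_matrix_def matrix_vector_mult_def poly_vec_def approx_op_def vec_eq_iff
      mult.commute)

section \<open>From the pointwise bound to the integrated one\<close>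

text \<open>\<open>f\<close> need not be measurable: a non-integrable function has integral 0, which only helps.\<close>

lemma L2_norm_bound:
  fixes f g h :: "real \<Rightarrow> _"
  assumes le: "\<And>t. t \<in> {-1<..<1} \<Longrightarrow>
        (mat_norm M (f t))\<^sup>2 \<le> k\<^sup>2 * (2 * (mat_norm M (g t))\<^sup>2 + 2 * \<sigma>\<^sup>2 * (norm (h t))\<^sup>2)"
    and k: "k > 0" and \<sigma>: "\<sigma> \<ge> 0"
    and g: "set_integrable lborel {-1<..<1} (\<lambda>t. (mat_norm M (g t))\<^sup>2)"
    and h: "set_integrable lborel {-1..1} (\<lambda>t. (norm (h t))\<^sup>2)"
      "(LINT t:{-1..1}|lborel. (norm (h t))\<^sup>2) \<le> B"
  shows "inverse k * L2_norm M f \<le> sqrt 2 * L2_norm M g + \<sigma> * sqrt (2 * B)"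
proof -
  let ?F = "LINT t:{-1<..<1}|lborel. (mat_norm M (f t))\<^sup>2"
  let ?G = "LINT t:{-1<..<1}|lborel. (mat_norm M (g t))\<^sup>2"
  let ?H = "LINT t:{-1<..<1}|lborel. (norm (h t))\<^sup>2"
  have h': "set_integrable lborel {-1<..<1} (\<lambda>t. (norm (h t))\<^sup>2)"
    by (rule set_integrable_subset[OF h(1)]) auto
  have G: "?G \<ge> 0" and H: "?H \<ge> 0"
    by (simp_all add: set_lebesgue_integral_def)
  \<comment> \<open>The bound \<open>B\<close> concerns the closed interval, \<open>L2_norm\<close>
    the open one; the integrand is nonnegative.\<close>
  have "?H \<le> (LINT t:{-1..1}|lborel. (norm (h t))\<^sup>2)"
    using h(1) h' unfolding set_lebesgue_integral_def set_integrable_def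
    by (intro integral_mono) (auto simp: indicator_def)
  then have HB: "?H \<le> B" using h(2) by simp
  have "?F \<le> k\<^sup>2 * (2 * ?G + 2 * \<sigma>\<^sup>2 * ?H)"
  proof (cases "set_integrable lborel {-1<..<1} (\<lambda>t. (mat_norm M (f t))\<^sup>2)")
    case True
    have "?F \<le> (LINT t:{-1<..<1}|lborel.
        k\<^sup>2 * (2 * (mat_norm M (g t))\<^sup>2 + 2 * \<sigma>\<^sup>2 * (norm (h t))\<^sup>2))"
      using le by (intro set_integral_mono True set_integrable_mult_right set_integral_add g h') auto
    also have "\<dots> = k\<^sup>2 * (2 * ?G + 2 * \<sigma>\<^sup>2 * ?H)"
      using g h' by (simp add: set_integral_add)
    finally show ?thesis .
  next
    case False
    then have "?F = 0"
      unfolding set_lebesgue_integral_def set_integrable_def by (rule not_integrable_integral_eq)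
    then show ?thesis using G H by simp
  qed
  also have "\<dots> \<le> k\<^sup>2 * (2 * ?G + 2 * \<sigma>\<^sup>2 * B)"
    using HB by (intro mult_left_mono add_left_mono) auto
  finally have "L2_norm M f \<le> sqrt (k\<^sup>2 * (2 * ?G + 2 * \<sigma>\<^sup>2 * B))"
    unfolding L2_norm_def by (rule real_sqrt_le_mono)
  also have "\<dots> = k * sqrt (2 * ?G + \<sigma>\<^sup>2 * (2 * B))"
    using k by (simp add: real_sqrt_mult mult_ac)
  also have "\<dots> \<le> k * (sqrt (2 * ?G) + sqrt (\<sigma>\<^sup>2 * (2 * B)))"
    using k G H HB by (intro mult_left_mono sqrt_add_le_add_sqrt) auto
  also have "\<dots> = k * (sqrt 2 * L2_norm M g + \<sigma> * sqrt (2 * B))"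
    using \<sigma> by (simp add: real_sqrt_mult L2_norm_def)
  finally show ?thesis
    using k by (simp add: field_simps)
qed

section \<open>The error estimate for the POD subspace solution\<close>

theorem theorem5p2:
  fixes \<Omega> :: "(real^'d) set"
    and L :: "(real^'d \<Rightarrow> real) \<Rightarrow> real"
    and a0 a1 :: "(real^'d \<Rightarrow> real) \<Rightarrow> (real^'d \<Rightarrow> real) \<Rightarrow> real"
    and r C :: real
    and Xh :: "(real^'d \<Rightarrow> real) set"
    and \<phi> :: "'m::finite \<Rightarrow> real^'d \<Rightarrow> real"
    and A0 A1 :: "real^'m^'m" and A :: "real \<Rightarrow> real^'m^'m" and b :: "real^'m"
    and n s :: nat
    and y w :: "'N::finite \<Rightarrow> real"
    and x xPOD :: "real \<Rightarrow> real^'m"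
    and W :: "real^'N^'N" and X Xt Xs :: "real^'N^'m"
    and VPOD :: "(real^'m) set"
    and P :: "nat \<Rightarrow> real poly" and \<alpha> :: "'N \<Rightarrow> real poly"
    and e \<sigma> \<kappa> Cs :: real
  assumes dim: "CARD('d) \<in> {2, 3}"
    and domain: "lipschitz_domain \<Omega>"
    and L: "bounded_functional \<Omega> L"
    and a0: "symmetric_form \<Omega> a0" "continuous_bilinear_form \<Omega> a0" "coercive_form \<Omega> a0"
    and a1: "symmetric_form \<Omega> a1" "continuous_bilinear_form \<Omega> a1" "psd_form \<Omega> a1"
    and r: "0 < r" "r < 1" "\<And>v. v \<in> H10 \<Omega> \<Longrightarrow> a1 v v \<le> (1 - r) * a0 v v"
    and C: "C > 0"
      "\<And>v z. v \<in> H10 \<Omega> \<Longrightarrow> z \<in> H10 \<Omega> \<Longrightarrow> \<bar>a1 v z\<bar> \<le> C * sqrt (a0 v v) * sqrt (a0 z z)"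
    and Xh: "Xh \<subseteq> H10 \<Omega>" "linear_subspace Xh" "basis_of \<Omega> Xh \<phi>"
    and A0: "A0 = form_matrix a0 \<phi>"
    and A1: "A1 = form_matrix a1 \<phi>"
    and A: "A = (\<lambda>t. A0 + t *\<^sub>R A1)"
    and b: "b = load_vector L \<phi>"
    and y: "\<And>i. y i \<in> {-1<..<1}"
    and w: "\<And>i. w i > 0" "(\<Sum>i\<in>UNIV. w i) = 2"
    and D: "inner_product_on (Pn n) (discrete_ip y w)"
    and x: "\<And>t. t \<in> {-1<..<1} \<Longrightarrow> A t *v x t = b"
    and s: "s > 0"
    and X: "X = snapshot_matrix x y"
    and W: "W = weight_matrix w"
    and Xt: "Xt = X ** W"
    and Xs: "best_rank_approx A0 s Xt Xs"
    and \<sigma>: "\<sigma> = op_norm A0 (Xt - Xs)"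
    and VPOD: "VPOD = range (\<lambda>\<eta>. Xs *v \<eta>)"
    and xPOD: "\<And>t. t \<in> {-1<..<1} \<Longrightarrow> subspace_solution VPOD (A t) b (xPOD t)"
    and e: "e = quad_error n y w" "e < 1"
    and P: "normalized_orthogonal_basis n (discrete_ip y w) P"
    and \<alpha>: "\<And>i. \<alpha> i \<in> Pn n"
      "\<And>t j. t \<in> {-1<..<1} \<Longrightarrow> j \<le> n \<Longrightarrow> Phi_row P y j \<bullet> poly_vec \<alpha> t = poly (P j) t"
      "(LINT t:{-1..1}|lborel. (norm (matrix_inv W *v poly_vec \<alpha> t))\<^sup>2) \<le> (real n + 1) / (1 - e)"
    and \<kappa>: "\<kappa> = sqrt ((1 + C) / r)"
    and Cs: "Cs = sqrt ((2 * real n + 2) / (1 - e))"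
  shows "inverse \<kappa> * L2_norm A0 (\<lambda>t. x t - xPOD t)
           \<le> sqrt 2 * L2_norm A0 (\<lambda>t. x t - approx_op \<alpha> y x t) + \<sigma> * Cs"
proof -
  define u where "u z = (\<lambda>p. \<Sum>i\<in>UNIV. z $ i * \<phi> i p)" for z :: "real^'m"
  have \<phi>: "\<phi> i \<in> Xh" for i using Xh(3) by (simp add: basis_of_def)
  have uH: "u z \<in> H10 \<Omega>" for z
    using linear_subspace_sum[OF Xh(2), of UNIV \<phi>] \<phi> Xh(1) by (auto simp: u_def)
  have A0u: "z \<bullet> (A0 *v z) = a0 (u z) (u z)" and A1u: "z \<bullet> (A1 *v z) = a1 (u z) (u z)" for z
    unfolding A0 A1 u_def
    by (rule inner_form_matrix[OF a0(2) Xh(2,1) \<phi>] inner_form_matrix[OF a1(2) Xh(2,1) \<phi>])+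
  have A0_pos: "0 < z \<bullet> (A0 *v z)" if "z \<noteq> 0" for z
  proof -
    \<comment> \<open>The basis is linearly independent up to null sets, so nonzero coordinates give
      a nonzero class.\<close>
    have "\<not> (AE p in lebesgue_on \<Omega>. u z p = 0)"
      using Xh(3) that by (auto simp: basis_of_def u_def vec_eq_iff)
    then show ?thesis
      using coercive_form_pos[OF a0(3) uH] A0u by simp
  qed
  then have A0_nonneg: "0 \<le> z \<bullet> (A0 *v z)" for z
    by (cases "z = 0") (auto simp: less_imp_le)
  have A_eq: "z \<bullet> (A t *v z) = z \<bullet> (A0 *v z) + t * (z \<bullet> (A1 *v z))" for t z
    by (simp add: A matrix_vector_mult_add_rdistrib inner_add_right scaleR_matrix_vector_assoc[symmetric])
  \<comment> \<open>As \<open>a1\<close> is nonnegative on the diagonal, the extreme cases are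
    \<open>t = -1\<close>, where \<open>1 - (1 - r) = r\<close> remains, and \<open>t = 1\<close>,
    which gives \<open>1 + C\<close>. The endpoints are included so that \<open>A t\<close> is
    invertible on a compact interval.\<close>
  have A_lower: "r * (z \<bullet> (A0 *v z)) \<le> z \<bullet> (A t *v z)"
    and A_upper: "z \<bullet> (A t *v z) \<le> (1 + C) * (z \<bullet> (A0 *v z))" if t: "t \<in> {-1..1}" for t z
  proof -
    have p: "0 \<le> z \<bullet> (A1 *v z)"
      using a1(3) uH by (simp add: A1u psd_form_def)
    have q: "z \<bullet> (A1 *v z) \<le> (1 - r) * (z \<bullet> (A0 *v z))"
      unfolding A0u A1u by (rule r(3)[OF uH])
    have "z \<bullet> (A1 *v z) \<le> C * (z \<bullet> (A0 *v z))"
      using C(2)[OF uH uH, of z z] A0_nonneg[of z] by (simp add: A0u A1u mult.assoc)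
    moreover have "t * (z \<bullet> (A1 *v z)) \<le> z \<bullet> (A1 *v z)" "- (z \<bullet> (A1 *v z)) \<le> t * (z \<bullet> (A1 *v z))"
      using t p mult_right_mono[of t 1 "z \<bullet> (A1 *v z)"] mult_right_mono[of "-1" t "z \<bullet> (A1 *v z)"]
      by auto
    ultimately show "r * (z \<bullet> (A0 *v z)) \<le> z \<bullet> (A t *v z)"
      "z \<bullet> (A t *v z) \<le> (1 + C) * (z \<bullet> (A0 *v z))"
      using q unfolding A_eq by (simp_all add: algebra_simps)
  qed
  have A_sym: "transpose (A t) = A t" for t
  proof -
    have "transpose A0 = A0" "transpose A1 = A1"
      unfolding A0 A1 using a0(1) a1(1) \<phi> Xh(1) by (auto intro: transpose_form_matrix)
    then show ?thesis by (simp add: A transpose_def vec_eq_iff)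
  qed
  have \<kappa>_pos: "\<kappa> > 0" and \<kappa>_sq: "\<kappa>\<^sup>2 = (1 + C) / r"
    using C(1) r(1) by (simp_all add: \<kappa>)

  \<comment> \<open>The weights cancel in \<open>Xt *v h t\<close>, which leaves the approximation
    operator applied to \<open>x\<close>; the assumed integral bound on \<alpha> is a bound on
    exactly this \<open>h\<close>.\<close>
  define h where "h t = matrix_inv W *v poly_vec \<alpha> t" for t
  have WW: "W ** matrix_inv W = mat 1"
    unfolding W using w(1) by (rule weight_matrix_inverse)
  have Xth: "Xt *v h t = approx_op \<alpha> y x t" for t
  proof -
    have "Xt *v h t = X *v ((W ** matrix_inv W) *v poly_vec \<alpha> t)"
      by (simp add: h_def Xt matrix_vector_mul_assoc matrix_mul_assoc)
    then show ?thesis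
      by (simp add: WW X snapshot_matrix_mult)
  qed
  have \<sigma>_nonneg: "\<sigma> \<ge> 0"
    unfolding \<sigma> using A0_nonneg by (rule op_norm_nonneg)

  have pointwise: "(mat_norm A0 (x t - xPOD t))\<^sup>2 \<le>
      \<kappa>\<^sup>2 * (2 * (mat_norm A0 (x t - approx_op \<alpha> y x t))\<^sup>2 + 2 * \<sigma>\<^sup>2 * (norm (h t))\<^sup>2)"
    if t: "t \<in> {-1<..<1}" for t
  proof -
    have t': "t \<in> {-1..1}" using t by auto
    define v where "v = Xs *v h t"
    define d where "d = x t - xPOD t"
    have psd: "0 \<le> z \<bullet> (A t *v z)" for z
      using A_lower[OF t', of z] A0_nonneg[of z] r(1) by (meson mult_nonneg_nonneg less_imp_le order_trans)
    have "v \<in> VPOD" by (simp add: VPOD v_def)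
    then have "d \<bullet> (A t *v d) \<le> (x t - v) \<bullet> (A t *v (x t - v))"
      unfolding d_def by (rule subspace_solution_best[OF A_sym psd x[OF t] xPOD[OF t]])
    \<comment> \<open>Dividing by \<open>r\<close> yields the factor \<open>(1 + C) / r\<close>, the
      square of \<kappa>.\<close>
    then have "r * (d \<bullet> (A0 *v d)) \<le> (1 + C) * ((x t - v) \<bullet> (A0 *v (x t - v)))"
      using A_lower[OF t', of d] A_upper[OF t', of "x t - v"] by linarith
    then have "(mat_norm A0 d)\<^sup>2 \<le> \<kappa>\<^sup>2 * (mat_norm A0 (x t - v))\<^sup>2"
      using r(1) by (simp add: mat_norm_def A0_nonneg \<kappa>_sq field_simps)
    also have "x t - v = (x t - approx_op \<alpha> y x t) + (Xt - Xs) *v h t"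
      by (simp add: Xth v_def matrix_vector_mult_diff_rdistrib)
    also have "(mat_norm A0 \<dots>)\<^sup>2 \<le> 2 * (mat_norm A0 (x t - approx_op \<alpha> y x t))\<^sup>2
        + 2 * (mat_norm A0 ((Xt - Xs) *v h t))\<^sup>2"
      using A0_nonneg by (rule mat_norm_add_sq)
    also have "(mat_norm A0 ((Xt - Xs) *v h t))\<^sup>2 \<le> (\<sigma> * norm (h t))\<^sup>2"
      unfolding \<sigma> by (intro power_mono mat_norm_le_op_norm) (simp add: mat_norm_def A0_nonneg)
    finally show ?thesis
      by (simp add: d_def power_mult_distrib mult_left_mono mult.assoc)
  qed

  have "det (A t) \<noteq> 0" if "t \<in> {-1..1}" for t
    using A_lower[OF that] A0_pos r(1)
    by (intro det_nonzero_of_definite) (meson mult_pos_pos less_le_trans)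
  moreover have "continuous_on {-1..1} A"
    unfolding A by (intro continuous_intros)
  \<comment> \<open>The values of \<open>x\<close> at the endpoints are unconstrained;
    \<open>z\<close> is continuous up to them and agrees with \<open>x\<close> on the open interval,
    so integrability transfers.\<close>
  ultimately obtain z where z: "continuous_on {-1..1} z"
    "\<And>t v. t \<in> {-1..1} \<Longrightarrow> A t *v v = b \<longleftrightarrow> v = z t"
    using continuous_linear_system_solution by blast
  have cont: "continuous_on {-1..1} (\<lambda>t. (z t - approx_op \<alpha> y x t) \<bullet> (A0 *v (z t - approx_op \<alpha> y x t)))"
    unfolding approx_op_def
    by (intro continuous_intros z(1)
        bounded_linear.continuous_on[OF matrix_vector_mul_bounded_linear])
  have "set_integrable lborel {-1<..<1} (\<lambda>t. (z t - approx_op \<alpha> y x t) \<bullet> (A0 *v (z t - approx_op \<alpha> y x t)))"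
    by (rule set_integrable_subset[OF borel_integrable_compact[OF _ cont, folded set_integrable_def]]) auto
  moreover have "z t = x t" if "t \<in> {-1<..<1}" for t
    using z(2)[of t "x t"] x[OF that] that by auto
  ultimately have g: "set_integrable lborel {-1<..<1} (\<lambda>t. (mat_norm A0 (x t - approx_op \<alpha> y x t))\<^sup>2)"
    by (subst set_integrable_cong[OF refl refl]) (auto simp: mat_norm_def A0_nonneg)
  have "continuous_on {-1..1} (poly_vec \<alpha>)"
    unfolding poly_vec_def[abs_def] by (intro continuous_intros)
  then have "continuous_on {-1..1} (\<lambda>t. (norm (h t))\<^sup>2)"
    unfolding h_def
    by (intro continuous_on_power continuous_on_norm
        bounded_linear.continuous_on[OF matrix_vector_mul_bounded_linear])
  then have h: "set_integrable lborel {-1..1} (\<lambda>t. (norm (h t))\<^sup>2)"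
    unfolding set_integrable_def by (intro borel_integrable_compact) auto

  \<comment> \<open>The 2 inside the root comes from the doubled squares in the pointwise bound; the
    rest is the bound on the integral of \<open>(norm (h t))\<^sup>2\<close>.\<close>
  have "Cs = sqrt (2 * ((real n + 1) / (1 - e)))"
    by (simp add: Cs algebra_simps)
  then show ?thesis
    by (simp only:)
      (rule L2_norm_bound[OF pointwise \<kappa>_pos \<sigma>_nonneg g h \<alpha>(3)[folded h_def]])
qed

end
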